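(* Let $m\in\mathbb N$ and let $m_2$ be an integer with $0\le m_2\le m$. Then: 1) If $m_2$ is even, (i) $$\begin{aligned}&{\rm ch}^{(+)}_{H(\Lambda^{[K(m),m_2]})}(\tau,z)-{\rm ch}^{(+)}_{H(\Lambda^{[K(m),0]})}(\tau,z)\\&=-i\,q^{-\frac m{16}}\frac1{\eta(\frac\tau2)\eta(2\tau)}\cdot\frac{\vartheta_{00}(\tau,z)}{\vartheta_{11}(\tau,z)}\sum_{k=0}^{\frac{m_2}2-1}(-1)^kq^{-\frac1m(k+\frac12)^2+\frac12(k+\frac12)}\big[\theta_{k+\frac12,\frac m2}-\theta_{-(k+\frac12),\frac m2}\big](2\tau,2z);\end{aligned}$$ (ii) $$\begin{aligned}&{\rm ch}^{(-)}_{H(\Lambda^{[K(m),m_2]})}(\tau,z)-{\rm ch}^{(-)}_{H(\Lambda^{[K(m),0]})}(\tau,z)\\&=q^{-\frac m{16}}\frac{\eta(\frac\tau2)}{\eta(\tau)^3}\cdot\frac{\vartheta_{01}(\tau,z)}{\vartheta_{11}(\tau,z)}\sum_{k=0}^{\frac{m_2}2-1}q^{-\frac1m(k+\frac12)^2+\frac12(k+\frac12)}\big[\theta_{k+\frac12,\frac m2}-\theta_{-(k+\frac12),\frac m2}\big](2\tau,2z).\end{aligned}$$ 2) If $m_2$ is odd, (i) $$\begin{aligned}&{\rm ch}^{(+)}_{H(\Lambda^{[K(m),m_2]})}(\tau,z)-{\rm ch}^{(+)}_{H(\Lambda^{[K(m),1]})}(\tau,z)\\&=-i\,q^{-\frac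 m{16}}\frac1{\eta(\frac\tau2)\eta(2\tau)}\cdot\frac{\vartheta_{00}(\tau,z)}{\vartheta_{11}(\tau,z)}\sum_{k=0}^{\frac{m_2-1}2}(-1)^kq^{-\frac{k^2}m+\frac k2}\big[\theta_{k,\frac m2}-\theta_{-k,\frac m2}\big](2\tau,2z);\end{aligned}$$ (ii) $$\begin{aligned}&{\rm ch}^{(-)}_{H(\Lambda^{[K(m),m_2]})}(\tau,z)-{\rm ch}^{(-)}_{H(\Lambda^{[K(m),1]})}(\tau,z)\\&=q^{-\frac m{16}}\frac{\eta(\frac\tau2)}{\eta(\tau)^3}\cdot\frac{\vartheta_{01}(\tau,z)}{\vartheta_{11}(\tau,z)}\sum_{k=0}^{\frac{m_2-1}2}q^{-\frac{k^2}m+\frac k2}\big[\theta_{k,\frac m2}-\theta_{-k,\frac m2}\big](2\tau,2z).\end{aligned}$$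
   Context: Notation. $\mathbb N$ = positive integers; $\tau$ in the upper half-plane; $z,z_1,z_2,t\in\mathbb C$; $q=e^{2\pi i\tau}$, $q^a:=e^{2\pi ia\tau}$. $\theta_{k,m}(\tau,z)=\sum_{j\in\mathbb Z}e^{2\pi im(j+\frac k{2m})z}q^{m(j+\frac k{2m})^2}$; $[\theta_{k,m}-\theta_{-k,m}](\tau,z)=\theta_{k,m}(\tau,z)-\theta_{-k,m}(\tau,z)$; $\eta$ is the Dedekind eta function; $\vartheta_{ab}(\tau,z)=\sum_{n\in\mathbb Z}e^{\pi i(n+\frac a2)^2\tau+2\pi i(n+\frac a2)(z+\frac b2)}$ ($a,b\in\{0,1\}$) are Mumford's theta functions. For $m\in\frac12\mathbb N$, $s\in\frac12\mathbb Z$, $\Phi^{[m,s]}=\Phi_1^{[m,s]}-\Phi_2^{[m,s]}$ with $$\Phi^{[m,s]}_1(\tau,z_1,z_2,t)=e^{-2\pi imt}\sum_{j\in\mathbb Z}\frac{e^{2\pi imj(z_1+z_2)+2\pi isz_1}q^{mj^2+sj}}{1-e^{2\pi iz_1}q^j},\quad \Phi^{[m,s]}_2(\tau,z_1,z_2,t)=e^{-2\pi imt}\sum_{j\in\mathbb Z}\frac{e^{-2\pi imj(z_1+z_2)-2\pi isz_2}q^{mj^2+sj}}{1-e^{-2\pi iz_2}q^j}.$$ In these definitions $q$ is attached to the first argument (first argument $2\tau$ means $q\mapsto q^2$). Empty sums are $0$. Modules. Let $\widehat B(1,1)=\widehat{osp}(3|2)$ be the affine Lie superalgebra with simple roots $\alpha_0,\alpha_1,\alpha_2$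 ($\alpha_1$ odd isotropic, $\alpha_0,\alpha_2$ even, $\theta=2\alpha_1+2\alpha_2$ the highest root, $(\theta|\theta)=2$) and fundamental weight $\Lambda_0$. For $m\in\mathbb N$ and an integer $0\le m_2\le m$ put $K(m)=-\frac{m+2}4$, $\Lambda^{[K(m),m_2]}=K(m)\Lambda_0-\frac{m_2}2\alpha_1$, let $L(\Lambda^{[K(m),m_2]})$ be the irreducible highest weight module, and let $H(\Lambda^{[K(m),m_2]})$ be the module over the N=3 superconformal algebra obtained from it by quantum Hamiltonian reduction. Its character ${\rm ch}^{(+)}$ and supercharacter ${\rm ch}^{(-)}$ are known (from earlier work) to be determined by $$R^{(+)}{\rm ch}^{(+)}_{H(\Lambda^{[K(m),m_2]})}(\tau,z)=q^{-\frac m{16}}\Phi^{[\frac m2,\frac{m_2+1}2]}\big(2\tau,z+\tfrac\tau2-\tfrac12,z-\tfrac\tau2+\tfrac12,0\big),$$ $$R^{(-)}{\rm ch}^{(-)}_{H(\Lambda^{[K(m),m_2]})}(\tau,z)=q^{-\frac m{16}}\Phi^{[\frac m2,\frac{m_2+1}2]}\big(2\tau,z+\tfrac\tau2,z-\tfrac\tau2,0\big),$$ where $R^{(+)}(\tau,z)=\eta(\frac\tau2)\eta(2\tau)\frac{\vartheta_{11}(\tau,z)}{\vartheta_{00}(\tau,z)}$ and $R^{(-)}(\tau,z)=\frac{\eta(\tau)^3}{\eta(\frac\tau2)}\cdot\frac{\vartheta_{11}(\tau,z)}{\vartheta_{01}(\tau,z)}$.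
   Formalization: The printed constant prefactors −i, 1, −i, 1 of 1(i), 1(ii), 2(i), 2(ii) are wrong for the given definitions (e.g. m=m₂=2 and m=m₂=3); the formal statement proves the formulas with i, −1, −1, −1 instead, at points where the theta functions in R^(±) do not vanish. *)

theory Defs
  imports "HOL-Analysis.Analysis"
begin

text \<open>
  Throughout, \<open>\<tau>\<close> is a point of the upper half-plane and \<open>z, z1, z2, t\<close> are complex numbers.
  All sums over the integers below converge absolutely for \<open>Im \<tau> > 0\<close> and positive \<open>m\<close>
  (for \<open>Phi1\<close>, \<open>Phi2\<close>: away from the zeros of the denominators), so \<open>infsum\<close> is the ordinary sum.
\<close>

text \<open>The power \<open>q^a\<close>, where \<open>q = exp (2 \<pi> i \<tau>)\<close>; no branch is involved.\<close>

definition qpow :: "complex \<Rightarrow> real \<Rightarrow> complex" where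
  "qpow \<tau> a = exp (2 * pi * \<i> * a * \<tau>)"

definition theta :: "real \<Rightarrow> real \<Rightarrow> complex \<Rightarrow> complex \<Rightarrow> complex" where
  "theta k m \<tau> z =
     (\<Sum>\<^sub>\<infinity>j\<in>(UNIV :: int set).
        exp (2 * pi * \<i> * m * (of_int j + k / (2 * m)) * z) *
        qpow \<tau> (m * (of_int j + k / (2 * m))\<^sup>2))"

definition theta_diff :: "real \<Rightarrow> real \<Rightarrow> complex \<Rightarrow> complex \<Rightarrow> complex" where
  "theta_diff k m \<tau> z = theta k m \<tau> z - theta (- k) m \<tau> z"

definition mumford_theta :: "nat \<Rightarrow> nat \<Rightarrow> complex \<Rightarrow> complex \<Rightarrow> complex" where
  "mumford_theta a b \<tau> z =
     (\<Sum>\<^sub>\<infinity>n\<in>(UNIV :: int set).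
        exp (pi * \<i> * (of_int n + of_nat a / 2)\<^sup>2 * \<tau>
             + 2 * pi * \<i> * (of_int n + of_nat a / 2) * (z + of_nat b / 2)))"

definition dedekind_eta :: "complex \<Rightarrow> complex" where
  "dedekind_eta \<tau> = qpow \<tau> (1 / 24) * (\<Prod>n. 1 - qpow \<tau> (real (Suc n)))"

definition Phi1 :: "real \<Rightarrow> real \<Rightarrow> complex \<Rightarrow> complex \<Rightarrow> complex \<Rightarrow> complex \<Rightarrow> complex" where
  "Phi1 m s \<tau> z1 z2 t =
     exp (- (2 * pi * \<i> * m * t)) *
     (\<Sum>\<^sub>\<infinity>j\<in>(UNIV :: int set).
        exp (2 * pi * \<i> * m * of_int j * (z1 + z2) + 2 * pi * \<i> * s * z1) * qpow \<tau> (m * (of_int j)\<^sup>2 + s * of_int j)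
        / (1 - exp (2 * pi * \<i> * z1) * qpow \<tau> (of_int j)))"

definition Phi2 :: "real \<Rightarrow> real \<Rightarrow> complex \<Rightarrow> complex \<Rightarrow> complex \<Rightarrow> complex \<Rightarrow> complex" where
  "Phi2 m s \<tau> z1 z2 t =
     exp (- (2 * pi * \<i> * m * t)) *
     (\<Sum>\<^sub>\<infinity>j\<in>(UNIV :: int set).
        exp (- (2 * pi * \<i> * m * of_int j * (z1 + z2)) - 2 * pi * \<i> * s * z2) * qpow \<tau> (m * (of_int j)\<^sup>2 + s * of_int j)
        / (1 - exp (- (2 * pi * \<i> * z2)) * qpow \<tau> (of_int j)))"

definition Phi :: "real \<Rightarrow> real \<Rightarrow> complex \<Rightarrow> complex \<Rightarrow> complex \<Rightarrow> complex \<Rightarrow> complex" where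
  "Phi m s \<tau> z1 z2 t = Phi1 m s \<tau> z1 z2 t - Phi2 m s \<tau> z1 z2 t"

definition R_plus :: "complex \<Rightarrow> complex \<Rightarrow> complex" where
  "R_plus \<tau> z =
     dedekind_eta (\<tau> / 2) * dedekind_eta (2 * \<tau>) * (mumford_theta 1 1 \<tau> z / mumford_theta 0 0 \<tau> z)"

definition R_minus :: "complex \<Rightarrow> complex \<Rightarrow> complex" where
  "R_minus \<tau> z =
     dedekind_eta \<tau> ^ 3 / dedekind_eta (\<tau> / 2) * (mumford_theta 1 1 \<tau> z / mumford_theta 0 1 \<tau> z)"

text \<open>
  Weights of the affine Lie superalgebra of type \<open>B(1,1)\<close>, as coordinate vectors with respect to
  the basis consisting of \<open>\<Lambda>\<^sub>0\<close> and the simple roots \<open>\<alpha>\<^sub>0, \<alpha>\<^sub>1, \<alpha>\<^sub>2\<close>, in this order. They only serve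
  to index the modules \<open>H(\<Lambda>)\<close>.
\<close>

type_synonym weight = "real \<times> real \<times> real \<times> real"

definition Lambda0 :: weight where "Lambda0 = (1, 0, 0, 0)"

definition alpha1 :: weight where "alpha1 = (0, 0, 1, 0)"

definition level_K :: "nat \<Rightarrow> real" where
  "level_K m = - ((real m + 2) / 4)"

definition Lambda_K :: "nat \<Rightarrow> nat \<Rightarrow> weight" where
  "Lambda_K m m2 = level_K m *\<^sub>R Lambda0 - (real m2 / 2) *\<^sub>R alpha1"

text \<open>
  The characters and supercharacters of the reduced modules \<open>H(\<Lambda>)\<close> are meromorphic functions that
  enter only through the known formulas determining them. The two predicates below say that a
  family of functions, indexed by the highest weight \<open>\<Lambda>\<close>, satisfies these formulas at all points
  where the theta functions in \<open>R_plus\<close> (respectively \<open>R_minus\<close>) do not vanish. There the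
  denominators in \<open>Phi\<close> do not vanish either, and division by zero does not occur.
\<close>

definition is_N3_character :: "(weight \<Rightarrow> complex \<Rightarrow> complex \<Rightarrow> complex) \<Rightarrow> bool" where
  "is_N3_character ch \<longleftrightarrow>
     (\<forall>m m2 \<tau> z. 1 \<le> m \<and> m2 \<le> m \<and> 0 < Im \<tau> \<and>
        mumford_theta 1 1 \<tau> z \<noteq> 0 \<and> mumford_theta 0 0 \<tau> z \<noteq> 0 \<longrightarrow>
        R_plus \<tau> z * ch (Lambda_K m m2) \<tau> z =
          qpow \<tau> (- (real m / 16)) *
          Phi (real m / 2) ((real m2 + 1) / 2) (2 * \<tau>) (z + \<tau> / 2 - 1 / 2) (z - \<tau> / 2 + 1 / 2) 0)"

definition is_N3_supercharacter :: "(weight \<Rightarrow> complex \<Rightarrow> complex \<Rightarrow> complex) \<Rightarrow> bool" where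
  "is_N3_supercharacter ch \<longleftrightarrow>
     (\<forall>m m2 \<tau> z. 1 \<le> m \<and> m2 \<le> m \<and> 0 < Im \<tau> \<and>
        mumford_theta 1 1 \<tau> z \<noteq> 0 \<and> mumford_theta 0 1 \<tau> z \<noteq> 0 \<longrightarrow>
        R_minus \<tau> z * ch (Lambda_K m m2) \<tau> z =
          qpow \<tau> (- (real m / 16)) *
          Phi (real m / 2) ((real m2 + 1) / 2) (2 * \<tau>) (z + \<tau> / 2) (z - \<tau> / 2) 0)"

text \<open>
  Erratum. The source prints the constant prefactors of the four difference formulas as \<open>-i, 1\<close>
  (\<open>m2\<close> even) and \<open>-i, 1\<close> (\<open>m2\<close> odd). With the above definitions these are incorrect: since
  \<open>x^(s+1) / (1 - x) - x^s / (1 - x) = - x^s\<close>, one has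
  \<open>Phi m (s+1) - Phi m s = - exp (\<pi> i s (z1 - z2)) q^(-s^2/(4m)) theta_diff s m \<tau> (z1 + z2)\<close> at \<open>t = 0\<close>.
  The character formulas have \<open>z1 - z2 = \<tau> - 1\<close>, so each summand carries \<open>- exp (- \<pi> i s)\<close>,
  which is \<open>i (-1)^k\<close> for \<open>s = k + 1/2\<close> and \<open>- (-1)^k\<close> for \<open>s = k\<close>; the supercharacter formulas have
  \<open>z1 - z2 = \<tau>\<close>, so each summand carries \<open>-1\<close>. The correct prefactors are thus \<open>i, -1\<close> (\<open>m2\<close> even)
  and \<open>-1, -1\<close> (\<open>m2\<close> odd).
\<close>

end

theory Submission
  imports Defs
begin

text \<open>
  Write \<open>x = exp (2 \<pi> i z1) q^j\<close> in the \<open>j\<close>-th term of \<open>Phi1\<close>. The parameter \<open>s\<close> enters that term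
  only through the factor \<open>x^s / (1 - x)\<close>, and \<open>x^(s+1) / (1 - x) - x^s / (1 - x) = - x^s\<close>. Raising
  \<open>s\<close> by 1 therefore removes the denominators altogether, and completing the square turns the
  remaining Gaussian sum into a theta function (\<open>Phi1_shift\<close>). The symmetry \<open>Phi2_eq_Phi1\<close> gives the
  same for \<open>Phi2\<close>, with \<open>theta (- s)\<close> in place of \<open>theta s\<close>, so that \<open>Phi\<close> changes by a
  multiple of \<open>theta_diff s\<close> (\<open>Phi_shift\<close>).

  In the character formulas \<open>s = (m2 + 1) / 2\<close>, so \<open>m2\<close> and \<open>m2 + 2\<close> differ by one such step. Iterating
  from \<open>m2 = 0\<close>, the steps are at \<open>s = k + 1/2\<close>. For odd \<open>m2\<close> the steps from \<open>m2 = 1\<close> are at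
  \<open>s = 1, 2, ...\<close>; the step at \<open>s = 0\<close> contributes \<open>theta_diff 0 = 0\<close>, which is why the sum may begin
  at \<open>k = 0\<close>.

  Three analytic points remain. The two series must be summed separately, so \<open>Phi1\<close> has to converge
  (\<open>summable_gaussian_over_one_minus_exp\<close>): its numerators decay like a Gaussian, and \<open>x\<close>
  stays away from the unit circle for all but finitely many \<open>j\<close>. No denominator may vanish: \<open>x = 1\<close>
  would force \<open>z\<close> to be a half-period at which \<open>mumford_theta 0 b\<close> has a zero
  (\<open>Phi_denominators_nonzero\<close>). Finally, dividing by \<open>R_plus\<close> and \<open>R_minus\<close> requires
  that the eta function has no zeros in the upper half-plane (\<open>dedekind_eta_nonzero\<close>).
\<close>

section \<open>Gaussian sums with denominators\<close>

lemma summable_exp_neg_abs_int: "(\<lambda>j::int. exp (- \<bar>real_of_int j\<bar>)) summable_on UNIV"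
proof -
  have "summable (\<lambda>n. exp (- 1 :: real) ^ n)"
    by (rule summable_geometric) simp
  hence "(\<lambda>n. exp (- 1 :: real) ^ n) summable_on UNIV"
    by (intro norm_summable_imp_summable_on) (simp add: norm_power)
  hence nat: "(\<lambda>n::nat. exp (- real n)) summable_on UNIV"
    by (simp add: exp_of_nat_mult[symmetric])
  have "(\<lambda>j::int. exp (- \<bar>real_of_int j\<bar>)) summable_on range int"
    by (subst summable_on_reindex) (use nat in \<open>simp_all add: o_def\<close>)
  moreover have "(\<lambda>j::int. exp (- \<bar>real_of_int j\<bar>)) summable_on range (\<lambda>n. - int n)"
    by (subst summable_on_reindex) (use nat in \<open>simp_all add: o_def inj_def\<close>)
  hence "(\<lambda>j::int. exp (- \<bar>real_of_int j\<bar>)) summable_on (range (\<lambda>n. - int n) - range int)"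
    by (rule summable_on_subset_banach) auto
  ultimately have "(\<lambda>j::int. exp (- \<bar>real_of_int j\<bar>)) summable_on
      (range int \<union> (range (\<lambda>n. - int n) - range int))"
    by (rule summable_on_Un_disjoint) auto
  moreover have "range int \<union> (range (\<lambda>n. - int n) - range int) = UNIV"
  proof -
    have "j \<in> range int \<union> range (\<lambda>n. - int n)" for j
      by (cases j rule: int_cases2) auto
    thus ?thesis by auto
  qed
  ultimately show ?thesis by simp
qed

text \<open>
  The exponent is a quadratic polynomial in \<open>j\<close> with negative leading coefficient, so after adding
  \<open>\<bar>j\<bar>\<close> it is still bounded above; this leaves the geometric bound \<open>exp (- \<bar>j\<bar>)\<close>.
\<close>

lemma abs_summable_gaussian:
  fixes A B C :: complex
  assumes "Re A < 0"
  shows "(\<lambda>j::int. norm (exp (A * of_int j ^ 2 + B * of_int j + C))) summable_on UNIV"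
proof (rule summable_on_comparison_test)
  define c K where "c = - Re A" and "K = (\<bar>Re B\<bar> + 1)\<^sup>2 / (4 * c) + Re C"
  have "c > 0" using assms by (simp add: c_def)
  show "(\<lambda>j::int. exp K * exp (- \<bar>real_of_int j\<bar>)) summable_on UNIV"
    by (intro summable_on_cmult_right summable_exp_neg_abs_int)
  fix j :: int
  define x where "x = \<bar>real_of_int j\<bar>"
  have sq: "(real_of_int j)\<^sup>2 = x\<^sup>2" by (simp add: x_def)
  have "Re B * real_of_int j \<le> \<bar>Re B\<bar> * x"
    unfolding x_def by (metis abs_ge_self abs_mult)
  moreover have "(\<bar>Re B\<bar> + 1) * x - c * x\<^sup>2 \<le> (\<bar>Re B\<bar> + 1)\<^sup>2 / (4 * c)"
  proof -
    have "0 \<le> (2 * c * x - (\<bar>Re B\<bar> + 1))\<^sup>2" by simp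
    thus ?thesis using \<open>c > 0\<close> by (simp add: field_simps power2_eq_square)
  qed
  \<comment> \<open>\<open>K\<close> contains the maximum over \<open>x\<close> of the quadratic just bounded; what is left over is \<open>- x\<close>.\<close>
  ultimately have "Re A * (real_of_int j)\<^sup>2 + Re B * real_of_int j + Re C \<le> K - x"
    unfolding K_def sq by (simp add: c_def algebra_simps)
  moreover have "Re (of_int j ^ 2 :: complex) = (real_of_int j)\<^sup>2"
      "Im (of_int j ^ 2 :: complex) = 0"
    by (simp_all add: power2_eq_square)
  ultimately show "norm (exp (A * of_int j ^ 2 + B * of_int j + C)) \<le> exp K * exp (- \<bar>real_of_int j\<bar>)"
    by (simp add: exp_add[symmetric] x_def)
qed simp

text \<open>
  The modulus of \<open>exp (P j + Q)\<close> is the exponential of a nonconstant real affine function of \<open>j\<close>. For all but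
  finitely many \<open>j\<close> that function has absolute value at least 1, which keeps the denominator at
  distance at least \<open>1/2\<close> from 0; the Gaussian bound of the numerator then suffices.
\<close>

lemma summable_gaussian_over_one_minus_exp:
  fixes A B C P Q :: complex
  assumes "Re A < 0" and "Re P \<noteq> 0"
  shows "(\<lambda>j::int. exp (A * of_int j ^ 2 + B * of_int j + C) / (1 - exp (P * of_int j + Q)))
           summable_on UNIV" (is "?f summable_on UNIV")
proof -
  define F where "F = {j::int. \<bar>Re P * real_of_int j + Re Q\<bar> < 1}"
  have "finite F"
  proof (rule finite_subset)
    define N where "N = (1 + \<bar>Re Q\<bar>) / \<bar>Re P\<bar>"
    show "F \<subseteq> {- \<lceil>N\<rceil>..\<lceil>N\<rceil>}"
    proof
      fix j assume "j \<in> F"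
      hence "\<bar>Re P * real_of_int j\<bar> \<le> 1 + \<bar>Re Q\<bar>" unfolding F_def by auto
      hence "\<bar>real_of_int j\<bar> \<le> N"
        using assms by (simp add: N_def field_simps abs_mult)
      thus "j \<in> {- \<lceil>N\<rceil>..\<lceil>N\<rceil>}" by (simp add: abs_le_iff) linarith
    qed
  qed simp
  have "(\<lambda>j. norm (?f j)) summable_on - F"
  proof (rule summable_on_comparison_test)
    show "(\<lambda>j::int. 2 * norm (exp (A * of_int j ^ 2 + B * of_int j + C))) summable_on - F"
      by (intro summable_on_cmult_right summable_on_subset_banach[OF abs_summable_gaussian[OF assms(1)]]) simp
    fix j :: int assume "j \<in> - F"
    define u where "u = Re P * real_of_int j + Re Q"
    have n: "norm (exp (P * of_int j + Q)) = exp u" by (simp add: u_def)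
    have "1 / 2 \<le> \<bar>1 - exp u\<bar>"
    proof (cases "u \<ge> 0")
      case True
      hence "u \<ge> 1" using \<open>j \<in> - F\<close> by (auto simp: F_def u_def)
      thus ?thesis using exp_ge_add_one_self[of u] by linarith
    next
      case False
      hence "- u \<ge> 1" using \<open>j \<in> - F\<close> by (auto simp: F_def u_def)
      hence "2 \<le> exp (- u)" using exp_ge_add_one_self[of "- u"] by linarith
      hence "exp u \<le> 1 / 2" by (simp add: exp_minus field_simps)
      thus ?thesis by linarith
    qed
    also have "\<dots> \<le> norm (1 - exp (P * of_int j + Q))"
      using norm_triangle_ineq3[of 1 "exp (P * of_int j + Q)"] by (simp only: n norm_one)
    finally have d: "1 / 2 \<le> norm (1 - exp (P * of_int j + Q))" .
    hence "norm (?f j) \<le> norm (exp (A * of_int j ^ 2 + B * of_int j + C)) / (1 / 2)"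
      unfolding norm_divide by (intro divide_left_mono) (auto intro!: mult_pos_pos)
    thus "norm (?f j) \<le> 2 * norm (exp (A * of_int j ^ 2 + B * of_int j + C))" by simp
  qed simp
  hence "?f summable_on - F" by (rule abs_summable_summable)
  moreover have "?f summable_on F" using \<open>finite F\<close> by simp
  ultimately have "?f summable_on (- F \<union> F)" by (rule summable_on_Un_disjoint) simp
  thus ?thesis by simp
qed

text \<open>
  With \<open>x = exp (P j + Q)\<close>, the shift \<open>(B, C) \<mapsto> (B + P, C + Q)\<close> multiplies the \<open>j\<close>-th numerator by
  \<open>x\<close>, and \<open>(x y - y) / (1 - x) = - y\<close>.
\<close>

lemma infsum_gaussian_over_one_minus_exp_shift:
  fixes A B C P Q :: complex
  assumes "Re A < 0" and "Re P \<noteq> 0" and "\<And>j::int. exp (P * of_int j + Q) \<noteq> 1"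
  shows "(\<Sum>\<^sub>\<infinity>j::int. exp (A * of_int j ^ 2 + (B + P) * of_int j + (C + Q)) / (1 - exp (P * of_int j + Q)))
       - (\<Sum>\<^sub>\<infinity>j::int. exp (A * of_int j ^ 2 + B * of_int j + C) / (1 - exp (P * of_int j + Q)))
       = - (\<Sum>\<^sub>\<infinity>j::int. exp (A * of_int j ^ 2 + B * of_int j + C))"
proof -
  have "exp (A * of_int j ^ 2 + (B + P) * of_int j + (C + Q)) / (1 - exp (P * of_int j + Q))
      - exp (A * of_int j ^ 2 + B * of_int j + C) / (1 - exp (P * of_int j + Q))
      = - exp (A * of_int j ^ 2 + B * of_int j + C)" for j :: int
  proof -
    have "exp (A * of_int j ^ 2 + (B + P) * of_int j + (C + Q))
        = exp (A * of_int j ^ 2 + B * of_int j + C) * exp (P * of_int j + Q)"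
      by (simp add: exp_add[symmetric] algebra_simps)
    moreover have "y * x / (1 - x) - y / (1 - x) = - y" if "x \<noteq> 1" for x y :: complex
      using that by (simp add: diff_divide_distrib[symmetric] field_simps)
    ultimately show ?thesis using assms(3)[of j] by simp
  qed
  moreover note summable_on = summable_gaussian_over_one_minus_exp[OF assms(1,2)]
  have "(\<Sum>\<^sub>\<infinity>j::int. exp (A * of_int j ^ 2 + (B + P) * of_int j + (C + Q)) / (1 - exp (P * of_int j + Q)))
       - (\<Sum>\<^sub>\<infinity>j::int. exp (A * of_int j ^ 2 + B * of_int j + C) / (1 - exp (P * of_int j + Q)))
       = (\<Sum>\<^sub>\<infinity>j::int. exp (A * of_int j ^ 2 + (B + P) * of_int j + (C + Q)) / (1 - exp (P * of_int j + Q))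
           + - (exp (A * of_int j ^ 2 + B * of_int j + C) / (1 - exp (P * of_int j + Q))))"
    by (subst infsum_add) (auto intro: summable_on simp: summable_on_uminus infsum_uminus)
  ultimately show ?thesis by (simp add: infsum_uminus)
qed

section \<open>Shifting the second index of Phi\<close>

text \<open>Completing the square, read backwards: \<open>m (j + k / (2 m))^2 = m j^2 + k j + k^2 / (4 m)\<close>.\<close>

lemma theta_eq_infsum_exp:
  assumes "m \<noteq> 0"
  shows "theta k m \<tau> z = exp (pi * \<i> * k * z) * qpow \<tau> (k\<^sup>2 / (4 * m)) *
     (\<Sum>\<^sub>\<infinity>j::int. exp (2 * pi * \<i> * m * \<tau> * of_int j ^ 2 + 2 * pi * \<i> * (m * z + k * \<tau>) * of_int j))"
  unfolding theta_def infsum_cmult_right'[symmetric]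
proof (rule infsum_cong, goal_cases)
  case (1 j)
  have "2 * pi * \<i> * m * (of_int j + k / (2 * m)) * z = 2 * pi * \<i> * m * of_int j * z + pi * \<i> * k * z"
    using assms by (simp add: field_simps)
  moreover have "m * (of_int j + k / (2 * m))\<^sup>2 = m * (of_int j)\<^sup>2 + k * of_int j + k\<^sup>2 / (4 * m)"
    using assms by (simp add: field_simps power2_eq_square)
  ultimately show ?case
    using assms unfolding qpow_def by (simp add: exp_add[symmetric] algebra_simps)
qed

lemma theta_neg: "theta k m \<tau> (- z) = theta (- k) m \<tau> z"
proof -
  have bij: "bij_betw uminus (UNIV :: int set) UNIV"
    by (simp add: bij_betw_def inj_def)
  have sq: "(of_int (- j) + k / (2 * m))\<^sup>2 = (of_int j + - k / (2 * m))\<^sup>2" for j :: int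
    by (simp add: power2_eq_square algebra_simps)
  show ?thesis
    unfolding theta_def
    by (subst infsum_reindex_bij_betw[OF bij, symmetric], rule infsum_cong, subst sq)
       (simp add: algebra_simps)
qed

text \<open>
  The sum on the right is a Gaussian in \<open>j\<close> whose linear coefficient is that of \<open>theta s m\<close> at
  \<open>z1 + z2\<close>. The factors in front arise from splitting
  \<open>2 \<pi> i s z1 = \<pi> i s (z1 + z2) + \<pi> i s (z1 - z2)\<close> and from completing the square.
\<close>

lemma Phi1_shift:
  assumes "m > 0" and "Im \<tau> > 0"
    and "\<And>j::int. exp (2 * pi * \<i> * z1) * qpow \<tau> (of_int j) \<noteq> 1"
  shows "Phi1 m (s + 1) \<tau> z1 z2 t - Phi1 m s \<tau> z1 z2 t =
    - (exp (- (2 * pi * \<i> * m * t)) * exp (pi * \<i> * s * (z1 - z2)) *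
       qpow \<tau> (- (s\<^sup>2 / (4 * m))) * theta s m \<tau> (z1 + z2))"
proof -
  define A P Q where "A = 2 * pi * \<i> * m * \<tau>" and "P = 2 * pi * \<i> * \<tau>" and "Q = 2 * pi * \<i> * z1"
  define B where "B = (\<lambda>s::real. 2 * pi * \<i> * (m * (z1 + z2) + s * \<tau>))"
  define C where "C = (\<lambda>s::real. s * Q)"
  have x: "exp (2 * pi * \<i> * z1) * qpow \<tau> (of_int j) = exp (P * of_int j + Q)" for j :: int
    unfolding qpow_def P_def Q_def by (simp add: exp_add[symmetric] algebra_simps)
  have num: "exp (2 * pi * \<i> * m * of_int j * (z1 + z2) + 2 * pi * \<i> * s * z1) *
      qpow \<tau> (m * (of_int j)\<^sup>2 + s * of_int j)
      = exp (A * of_int j ^ 2 + B s * of_int j + C s)" for j :: int and s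
    unfolding qpow_def A_def B_def C_def Q_def by (simp add: exp_add[symmetric] algebra_simps)
  have re: "Re A < 0" "Re P \<noteq> 0" using assms(1,2) by (simp_all add: A_def P_def)
  have ne: "exp (P * of_int j + Q) \<noteq> 1" for j :: int
    using assms(3)[of j] unfolding x .
  have shift: "B (s + 1) = B s + P" "C (s + 1) = C s + Q"
    by (simp_all add: B_def C_def P_def algebra_simps)
  have "Phi1 m (s + 1) \<tau> z1 z2 t - Phi1 m s \<tau> z1 z2 t =
     - (exp (- (2 * pi * \<i> * m * t)) * (\<Sum>\<^sub>\<infinity>j::int. exp (A * of_int j ^ 2 + B s * of_int j + C s)))"
    unfolding Phi1_def x num shift right_diff_distrib[symmetric]
      infsum_gaussian_over_one_minus_exp_shift[OF re ne] by simp
  also have "(\<Sum>\<^sub>\<infinity>j::int. exp (A * of_int j ^ 2 + B s * of_int j + C s)) =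
     exp (C s) * (\<Sum>\<^sub>\<infinity>j::int. exp (A * of_int j ^ 2 + B s * of_int j))"
    by (simp add: infsum_cmult_right'[symmetric] exp_add mult_ac)
  also have "exp (C s) = exp (pi * \<i> * s * (z1 - z2)) * qpow \<tau> (- (s\<^sup>2 / (4 * m))) *
      (exp (pi * \<i> * s * (z1 + z2)) * qpow \<tau> (s\<^sup>2 / (4 * m)))"
    unfolding C_def Q_def qpow_def by (simp add: exp_add[symmetric] algebra_simps)
  finally show ?thesis
    using assms(1) by (simp add: theta_eq_infsum_exp A_def B_def mult_ac)
qed

lemma Phi2_eq_Phi1: "Phi2 m s \<tau> z1 z2 t = Phi1 m s \<tau> (- z2) (- z1) t"
proof -
  have "2 * pi * \<i> * m * of_int j * (- z2 + - z1) + 2 * pi * \<i> * s * (- z2)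
      = - (2 * pi * \<i> * m * of_int j * (z1 + z2)) - 2 * pi * \<i> * s * z2" for j :: int
    by (simp add: algebra_simps)
  moreover have "2 * pi * \<i> * (- z2) = - (2 * pi * \<i> * z2)" by simp
  ultimately show ?thesis unfolding Phi1_def Phi2_def by (simp only:)
qed

text \<open>
  The substitution \<open>(z1, z2) \<mapsto> (- z2, - z1)\<close>, which exchanges the two halves of \<open>Phi\<close>, fixes
  \<open>z1 - z2\<close> and negates \<open>z1 + z2\<close>. Both halves thus contribute the same prefactor, and the two theta
  functions differ only in the sign of \<open>s\<close>.
\<close>

lemma Phi_shift:
  assumes "m > 0" and "Im \<tau> > 0"
    and "\<And>j::int. exp (2 * pi * \<i> * z1) * qpow \<tau> (of_int j) \<noteq> 1"
    and "\<And>j::int. exp (- (2 * pi * \<i> * z2)) * qpow \<tau> (of_int j) \<noteq> 1"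
  shows "Phi m (s + 1) \<tau> z1 z2 t - Phi m s \<tau> z1 z2 t =
    - (exp (- (2 * pi * \<i> * m * t)) * exp (pi * \<i> * s * (z1 - z2)) *
       qpow \<tau> (- (s\<^sup>2 / (4 * m))) * theta_diff s m \<tau> (z1 + z2))"
proof -
  have "theta s m \<tau> (- z2 + - z1) = theta (- s) m \<tau> (z1 + z2)"
    using theta_neg[of s m \<tau> "z1 + z2"] by (simp add: add.commute)
  thus ?thesis
    using Phi1_shift[of m \<tau> z1 s z2 t] Phi1_shift[of m \<tau> "- z2" s "- z1" t] assms
    unfolding Phi_def Phi2_eq_Phi1 theta_diff_def by (simp add: algebra_simps)
qed

lemma Phi_shift_nat:
  assumes "m > 0" and "Im \<tau> > 0"
    and "\<And>j::int. exp (2 * pi * \<i> * z1) * qpow \<tau> (of_int j) \<noteq> 1"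
    and "\<And>j::int. exp (- (2 * pi * \<i> * z2)) * qpow \<tau> (of_int j) \<noteq> 1"
  shows "Phi m (s + real n) \<tau> z1 z2 t - Phi m s \<tau> z1 z2 t =
    - (exp (- (2 * pi * \<i> * m * t)) * (\<Sum>k<n. exp (pi * \<i> * (s + real k) * (z1 - z2)) *
       qpow \<tau> (- ((s + real k)\<^sup>2 / (4 * m))) * theta_diff (s + real k) m \<tau> (z1 + z2)))"
proof -
  have "Phi m (s + real n) \<tau> z1 z2 t - Phi m s \<tau> z1 z2 t =
      (\<Sum>k<n. Phi m (s + real (Suc k)) \<tau> z1 z2 t - Phi m (s + real k) \<tau> z1 z2 t)"
    by (subst sum_lessThan_telescope) simp
  also have "\<dots> = (\<Sum>k<n. - (exp (- (2 * pi * \<i> * m * t)) * exp (pi * \<i> * (s + real k) * (z1 - z2)) *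
       qpow \<tau> (- ((s + real k)\<^sup>2 / (4 * m))) * theta_diff (s + real k) m \<tau> (z1 + z2)))"
  proof (rule sum.cong[OF refl])
    fix k
    show "Phi m (s + real (Suc k)) \<tau> z1 z2 t - Phi m (s + real k) \<tau> z1 z2 t =
       - (exp (- (2 * pi * \<i> * m * t)) * exp (pi * \<i> * (s + real k) * (z1 - z2)) *
       qpow \<tau> (- ((s + real k)\<^sup>2 / (4 * m))) * theta_diff (s + real k) m \<tau> (z1 + z2))"
      using Phi_shift[OF assms, of "s + real k" t] by (simp add: add_ac)
  qed
  finally show ?thesis
    by (simp add: sum_negf sum_distrib_left mult_ac)
qed

section \<open>Zeros of the theta and eta functions\<close>

text \<open>
  At these half-periods, completing the square in the exponent shows that the reflection
  \<open>l \<mapsto> - l - (2 a + 1)\<close> changes it by an odd multiple of \<open>\<pi> i\<close>. The reflection is a bijection of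
  the integers that negates every term, so the sum equals its own negative.
\<close>

lemma mumford_theta_zero:
  fixes a n :: int
  assumes "z + of_nat b / 2 = (of_int n + 1 / 2) + (of_int a + 1 / 2) * \<tau>"
  shows "mumford_theta 0 b \<tau> z = 0"
proof -
  define f where "f = (\<lambda>l::int. exp (pi * \<i> * (of_int l)\<^sup>2 * \<tau> + 2 * pi * \<i> * of_int l * (z + of_nat b / 2)))"
  define r where "r = (\<lambda>l::int. - l - (2 * a + 1))"
  have "bij r" by (rule bij_betw_byWitness[where f' = r]) (auto simp: r_def)
  hence "(\<Sum>\<^sub>\<infinity>l. f (r l)) = (\<Sum>\<^sub>\<infinity>l. f l)" by (rule infsum_reindex_bij_betw)
  moreover have "f (r l) = - f l" for l
  proof -
    have "pi * \<i> * (of_int (r l))\<^sup>2 * \<tau> + 2 * pi * \<i> * of_int (r l) * (z + of_nat b / 2)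
        = pi * \<i> * (of_int l)\<^sup>2 * \<tau> + 2 * pi * \<i> * of_int l * (z + of_nat b / 2)
          + (2 * of_int (- (2 * l + 2 * a + 1) * n - l - a - 1) * pi * \<i> + \<i> * pi)"
      unfolding assms r_def by (simp add: field_simps power2_eq_square)
    thus ?thesis
      unfolding f_def by (simp only: exp_add exp_integer_2pi[OF Ints_of_int]) (simp add: mult.commute)
  qed
  ultimately have "- (\<Sum>\<^sub>\<infinity>l. f l) = (\<Sum>\<^sub>\<infinity>l. f l)" by (simp add: infsum_uminus)
  hence "(\<Sum>\<^sub>\<infinity>l. f l) = 0" by (simp add: neg_equal_zero)
  thus ?thesis by (simp add: mumford_theta_def f_def)
qed

text \<open>
  An absolutely convergent product without vanishing factors is not zero.
\<close>

lemma dedekind_eta_nonzero: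
  assumes "Im \<tau> > 0"
  shows "dedekind_eta \<tau> \<noteq> 0"
proof -
  define q where "q = qpow \<tau> 1"
  have q: "qpow \<tau> (real n) = q ^ n" for n
    unfolding q_def qpow_def by (simp add: exp_of_nat_mult[symmetric] mult_ac)
  have "norm q < 1" using assms by (simp add: q_def qpow_def)
  have "summable (\<lambda>n. norm q ^ Suc n)"
    using \<open>norm q < 1\<close> by (subst summable_Suc_iff) (simp add: summable_geometric)
  hence "convergent_prod (\<lambda>n. 1 - q ^ Suc n)"
    by (intro abs_convergent_prod_imp_convergent_prod summable_imp_abs_convergent_prod)
       (simp add: norm_power norm_mult)
  moreover have "1 - q ^ Suc n \<noteq> 0" for n
  proof
    assume "1 - q ^ Suc n = 0"
    hence "q ^ Suc n = 1" by simp
    thus False using \<open>norm q < 1\<close> power_eq_1_iff[of q "Suc n"] by simp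
  qed
  ultimately have "(\<Prod>n. 1 - q ^ Suc n) \<noteq> 0" by (rule prodinf_nonzero)
  thus ?thesis unfolding dedekind_eta_def q by (simp add: qpow_def)
qed

lemma exp_eq_one_lattice:
  assumes "exp (2 * pi * \<i> * w) * qpow \<tau> (of_int j) = 1"
  obtains n :: int where "w = of_int n - of_int j * \<tau>"
proof -
  have "exp (2 * pi * \<i> * w + 2 * pi * \<i> * of_int j * \<tau>) = 1"
    using assms by (simp add: qpow_def exp_add)
  hence "exp (2 * pi * \<i> * w + 2 * pi * \<i> * of_int j * \<tau>) = exp 0" by simp
  then obtain n :: int where n: "2 * pi * \<i> * w + 2 * pi * \<i> * of_int j * \<tau> = of_int (2 * n) * pi * \<i>"
    unfolding exp_eq by auto
  hence "2 * pi * \<i> * (w + of_int j * \<tau>) = 2 * pi * \<i> * of_int n" by (simp add: algebra_simps)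
  hence "w + of_int j * \<tau> = of_int n" by simp
  thus ?thesis using that[of n] by (simp add: algebra_simps)
qed

text \<open>
  The characters use \<open>b = 0\<close>, \<open>c = 1/2\<close> and the supercharacters \<open>b = 1\<close>, \<open>c = 0\<close>; the parameter
  \<open>b\<close> treats both at once. A vanishing denominator would place \<open>z\<close> on the lattice translate
  consisting of zeros of \<open>mumford_theta 0 b\<close>.
\<close>

lemma Phi_denominators_nonzero:
  assumes "mumford_theta 0 b \<tau> z \<noteq> 0" and "c = (1 - of_nat b) / 2"
  shows "exp (2 * pi * \<i> * (z + \<tau> / 2 - c)) * qpow (2 * \<tau>) (of_int j) \<noteq> 1"
    and "exp (- (2 * pi * \<i> * (z - \<tau> / 2 + c))) * qpow (2 * \<tau>) (of_int j) \<noteq> 1"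
proof -
  show "exp (2 * pi * \<i> * (z + \<tau> / 2 - c)) * qpow (2 * \<tau>) (of_int j) \<noteq> 1"
  proof
    assume "exp (2 * pi * \<i> * (z + \<tau> / 2 - c)) * qpow (2 * \<tau>) (of_int j) = 1"
    then obtain n :: int where "z + \<tau> / 2 - c = of_int n - of_int j * (2 * \<tau>)"
      by (rule exp_eq_one_lattice)
    hence "z + of_nat b / 2 = (of_int n + 1 / 2) + (of_int (- 2 * j - 1) + 1 / 2) * \<tau>"
      by (simp add: assms(2) algebra_simps diff_divide_distrib)
    thus False using assms(1) mumford_theta_zero by blast
  qed
  show "exp (- (2 * pi * \<i> * (z - \<tau> / 2 + c))) * qpow (2 * \<tau>) (of_int j) \<noteq> 1"
  proof
    assume "exp (- (2 * pi * \<i> * (z - \<tau> / 2 + c))) * qpow (2 * \<tau>) (of_int j) = 1"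
    hence "exp (2 * pi * \<i> * (- (z - \<tau> / 2 + c))) * qpow (2 * \<tau>) (of_int j) = 1"
      by (simp only: mult_minus_right)
    then obtain n :: int where "- (z - \<tau> / 2 + c) = of_int n - of_int j * (2 * \<tau>)"
      by (rule exp_eq_one_lattice)
    hence z: "z = \<tau> / 2 - c - of_int n + of_int j * (2 * \<tau>)"
      by (simp add: algebra_simps)
    have "z + of_nat b / 2 = (of_int (int b - 1 - n) + 1 / 2) + (of_int (2 * j) + 1 / 2) * \<tau>"
      unfolding z assms(2) by (simp add: field_simps)
    thus False using assms(1) mumford_theta_zero by blast
  qed
qed

section \<open>Differences of characters\<close>

text \<open>
  Here \<open>z1 + z2 = 2 z\<close> and \<open>z1 - z2 = \<tau> - 2 c\<close>: the \<open>\<tau>\<close> gives the power \<open>q^((s + k) / 2)\<close> in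
  each summand, and \<open>c\<close> the phase, which is trivial for the supercharacters.
\<close>

lemma Phi_shift_half_period:
  fixes c :: complex
  assumes "m > 0" and "Im \<tau> > 0" and "mumford_theta 0 b \<tau> z \<noteq> 0" and "c = (1 - of_nat b) / 2"
  shows "Phi (m / 2) (s + real n) (2 * \<tau>) (z + \<tau> / 2 - c) (z - \<tau> / 2 + c) 0
       - Phi (m / 2) s (2 * \<tau>) (z + \<tau> / 2 - c) (z - \<tau> / 2 + c) 0
       = - (\<Sum>k<n. exp (- (2 * c * (pi * \<i> * (s + real k)))) *
             qpow \<tau> (- ((s + real k)\<^sup>2 / m) + (s + real k) / 2) *
             theta_diff (s + real k) (m / 2) (2 * \<tau>) (2 * z))"
proof -
  have e: "exp (pi * \<i> * u * (z + \<tau> / 2 - c - (z - \<tau> / 2 + c))) * qpow (2 * \<tau>) (- (u\<^sup>2 / (4 * (m / 2))))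
      = exp (- (2 * c * (pi * \<i> * u))) * qpow \<tau> (- (u\<^sup>2 / m) + u / 2)" for u :: real
    unfolding qpow_def using \<open>m > 0\<close>
    by (simp add: exp_add[symmetric] algebra_simps diff_divide_distrib)
  have z: "z + \<tau> / 2 - c + (z - \<tau> / 2 + c) = 2 * z" by simp
  have "m / 2 > 0" "Im (2 * \<tau>) > 0" using assms by simp_all
  note P = Phi_shift_nat[OF this Phi_denominators_nonzero[OF assms(3,4)], where t = 0]
  show ?thesis unfolding P e z by simp
qed

lemma diff_eq_of_mult_ratio:
  fixes E t u p a b X Y :: complex
  assumes "E * (t / u) * a = p * X" and "E * (t / u) * b = p * Y"
    and "E \<noteq> 0" and "t \<noteq> 0" and "u \<noteq> 0"
  shows "a - b = p * (1 / E) * (u / t) * (X - Y)"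
proof -
  have "E * (t / u) * (a - b) = p * (X - Y)"
    using assms(1,2) by (simp add: right_diff_distrib)
  thus ?thesis using assms(3-5) by (simp add: field_simps)
qed

text \<open>
  The starting index \<open>s\<close> is tied to \<open>m3\<close> only through the value of \<open>Phi\<close>, not by
  \<open>s = (m3 + 1) / 2\<close>. This allows \<open>s = 0\<close> for \<open>m3 = 1\<close>, so that the sum for odd \<open>m2\<close> includes
  its vanishing term at \<open>k = 0\<close>. The supercharacter version below has the same form.
\<close>

lemma N3_character_diff:
  assumes "is_N3_character ch" and "1 \<le> m" and "m2 \<le> m" and "m3 \<le> m" and "Im \<tau> > 0"
    and "mumford_theta 1 1 \<tau> z \<noteq> 0" and "mumford_theta 0 0 \<tau> z \<noteq> 0"
    and "(real m2 + 1) / 2 = s + real n"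
    and "Phi (real m / 2) ((real m3 + 1) / 2) (2 * \<tau>) (z + \<tau> / 2 - 1 / 2) (z - \<tau> / 2 + 1 / 2) 0
       = Phi (real m / 2) s (2 * \<tau>) (z + \<tau> / 2 - 1 / 2) (z - \<tau> / 2 + 1 / 2) 0"
  shows "ch (Lambda_K m m2) \<tau> z - ch (Lambda_K m m3) \<tau> z =
    qpow \<tau> (- (real m / 16)) * (1 / (dedekind_eta (\<tau> / 2) * dedekind_eta (2 * \<tau>))) *
    (mumford_theta 0 0 \<tau> z / mumford_theta 1 1 \<tau> z) *
    - (\<Sum>k<n. exp (- (pi * \<i> * (s + real k))) *
         qpow \<tau> (- ((s + real k)\<^sup>2 / real m) + (s + real k) / 2) *
         theta_diff (s + real k) (real m / 2) (2 * \<tau>) (2 * z))"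
proof -
  note ch = assms(1)[unfolded is_N3_character_def R_plus_def, rule_format, of m _ \<tau> z]
  have "dedekind_eta (\<tau> / 2) * dedekind_eta (2 * \<tau>) \<noteq> 0"
    using assms(5) by (simp add: dedekind_eta_nonzero)
  note d = diff_eq_of_mult_ratio[OF ch ch this assms(6,7), of m2 m3]
  have "real m > 0" using assms(2) by simp
  note P = Phi_shift_half_period[OF this assms(5,7), of "1 / 2" s n]
  show ?thesis
    using d P assms by simp
qed

lemma N3_supercharacter_diff:
  assumes "is_N3_supercharacter ch" and "1 \<le> m" and "m2 \<le> m" and "m3 \<le> m" and "Im \<tau> > 0"
    and "mumford_theta 1 1 \<tau> z \<noteq> 0" and "mumford_theta 0 1 \<tau> z \<noteq> 0"
    and "(real m2 + 1) / 2 = s + real n"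
    and "Phi (real m / 2) ((real m3 + 1) / 2) (2 * \<tau>) (z + \<tau> / 2) (z - \<tau> / 2) 0
       = Phi (real m / 2) s (2 * \<tau>) (z + \<tau> / 2) (z - \<tau> / 2) 0"
  shows "ch (Lambda_K m m2) \<tau> z - ch (Lambda_K m m3) \<tau> z =
    qpow \<tau> (- (real m / 16)) * (dedekind_eta (\<tau> / 2) / dedekind_eta \<tau> ^ 3) *
    (mumford_theta 0 1 \<tau> z / mumford_theta 1 1 \<tau> z) *
    - (\<Sum>k<n. qpow \<tau> (- ((s + real k)\<^sup>2 / real m) + (s + real k) / 2) *
         theta_diff (s + real k) (real m / 2) (2 * \<tau>) (2 * z))"
proof -
  note ch = assms(1)[unfolded is_N3_supercharacter_def R_minus_def, rule_format, of m _ \<tau> z]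
  have "dedekind_eta \<tau> ^ 3 / dedekind_eta (\<tau> / 2) \<noteq> 0"
    using assms(5) by (simp add: dedekind_eta_nonzero)
  note d = diff_eq_of_mult_ratio[OF ch ch this assms(6,7), of m2 m3]
  have "real m > 0" using assms(2) by simp
  note P = Phi_shift_half_period[OF this assms(5,7), of 0 s n]
  show ?thesis
    using d P assms by simp
qed

text \<open>The only summand is a multiple of \<open>theta 0 - theta 0\<close>.\<close>

lemma Phi_one_eq_Phi_zero:
  fixes c :: complex
  assumes "m > 0" and "Im \<tau> > 0" and "mumford_theta 0 b \<tau> z \<noteq> 0" and "c = (1 - of_nat b) / 2"
  shows "Phi (m / 2) 1 (2 * \<tau>) (z + \<tau> / 2 - c) (z - \<tau> / 2 + c) 0
       = Phi (m / 2) 0 (2 * \<tau>) (z + \<tau> / 2 - c) (z - \<tau> / 2 + c) 0"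
  using Phi_shift_half_period[OF assms, of 0 1] by (simp add: theta_diff_def)

lemma exp_neg_pi_i_nat: "exp (- (pi * \<i> * real k)) = (- 1) ^ k"
proof -
  have "exp (- (pi * \<i> * real k)) = exp (- (\<i> * pi)) ^ k"
    by (simp add: exp_of_nat_mult[symmetric] mult_ac)
  thus ?thesis by (simp add: exp_minus)
qed

lemma exp_neg_pi_i_nat_half: "exp (- (pi * \<i> * ((1 / 2 :: real) + real k))) = - \<i> * (- 1) ^ k"
proof -
  have "- (pi * \<i> * ((1 / 2 :: real) + real k)) = - (\<i> * of_real (pi / 2)) + - (pi * \<i> * real k)"
    by (simp add: algebra_simps)
  hence "exp (- (pi * \<i> * ((1 / 2 :: real) + real k))) = exp (- (\<i> * of_real (pi / 2))) * exp (- (pi * \<i> * real k))"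
    by (simp only: exp_add)
  also have "exp (- (\<i> * of_real (pi / 2))) = - \<i>"
    by (simp add: complex_eq_iff Re_exp Im_exp)
  finally show ?thesis by (simp only: exp_neg_pi_i_nat)
qed

theorem proposition4p3:
  fixes m m2 :: nat
    and ch_plus ch_minus :: "weight \<Rightarrow> complex \<Rightarrow> complex \<Rightarrow> complex"
    and \<tau> z :: complex
  assumes "1 \<le> m" and "m2 \<le> m" and "0 < Im \<tau>"
    and "is_N3_character ch_plus" and "is_N3_supercharacter ch_minus"
  shows
    "(even m2 \<longrightarrow>
       (mumford_theta 1 1 \<tau> z \<noteq> 0 \<and> mumford_theta 0 0 \<tau> z \<noteq> 0 \<longrightarrow>
          ch_plus (Lambda_K m m2) \<tau> z - ch_plus (Lambda_K m 0) \<tau> z =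
            \<i> * qpow \<tau> (- (real m / 16)) * (1 / (dedekind_eta (\<tau> / 2) * dedekind_eta (2 * \<tau>))) *
            (mumford_theta 0 0 \<tau> z / mumford_theta 1 1 \<tau> z) *
            (\<Sum>k<m2 div 2. (-1) ^ k *
               qpow \<tau> (- (1 / real m) * (real k + 1 / 2)\<^sup>2 + 1 / 2 * (real k + 1 / 2)) *
               theta_diff (real k + 1 / 2) (real m / 2) (2 * \<tau>) (2 * z))) \<and>
       (mumford_theta 1 1 \<tau> z \<noteq> 0 \<and> mumford_theta 0 1 \<tau> z \<noteq> 0 \<longrightarrow>
          ch_minus (Lambda_K m m2) \<tau> z - ch_minus (Lambda_K m 0) \<tau> z =
            - qpow \<tau> (- (real m / 16)) * (dedekind_eta (\<tau> / 2) / dedekind_eta \<tau> ^ 3) *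
            (mumford_theta 0 1 \<tau> z / mumford_theta 1 1 \<tau> z) *
            (\<Sum>k<m2 div 2.
               qpow \<tau> (- (1 / real m) * (real k + 1 / 2)\<^sup>2 + 1 / 2 * (real k + 1 / 2)) *
               theta_diff (real k + 1 / 2) (real m / 2) (2 * \<tau>) (2 * z))))
     \<and>
     (odd m2 \<longrightarrow>
       (mumford_theta 1 1 \<tau> z \<noteq> 0 \<and> mumford_theta 0 0 \<tau> z \<noteq> 0 \<longrightarrow>
          ch_plus (Lambda_K m m2) \<tau> z - ch_plus (Lambda_K m 1) \<tau> z =
            - qpow \<tau> (- (real m / 16)) * (1 / (dedekind_eta (\<tau> / 2) * dedekind_eta (2 * \<tau>))) *
            (mumford_theta 0 0 \<tau> z / mumford_theta 1 1 \<tau> z) *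
            (\<Sum>k = 0..(m2 - 1) div 2. (-1) ^ k *
               qpow \<tau> (- ((real k)\<^sup>2 / real m) + real k / 2) *
               theta_diff (real k) (real m / 2) (2 * \<tau>) (2 * z))) \<and>
       (mumford_theta 1 1 \<tau> z \<noteq> 0 \<and> mumford_theta 0 1 \<tau> z \<noteq> 0 \<longrightarrow>
          ch_minus (Lambda_K m m2) \<tau> z - ch_minus (Lambda_K m 1) \<tau> z =
            - qpow \<tau> (- (real m / 16)) * (dedekind_eta (\<tau> / 2) / dedekind_eta \<tau> ^ 3) *
            (mumford_theta 0 1 \<tau> z / mumford_theta 1 1 \<tau> z) *
            (\<Sum>k = 0..(m2 - 1) div 2.
               qpow \<tau> (- ((real k)\<^sup>2 / real m) + real k / 2) *
               theta_diff (real k) (real m / 2) (2 * \<tau>) (2 * z))))"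
proof (intro conjI impI; (elim conjE)?)
  have m: "real m > 0" using assms(1) by simp
  have half: "(real k + 1 / 2)\<^sup>2 = (1 / 2 + real k)\<^sup>2" "real k + 1 / 2 = 1 / 2 + real k" for k
    by simp_all
  have up_to: "{0..(m2 - 1) div 2} = {..<Suc ((m2 - 1) div 2)}"
    by auto
  {
    assume "even m2"
    hence n: "(real m2 + 1) / 2 = 1 / 2 + real (m2 div 2)" by (auto elim!: evenE)
    assume nz: "mumford_theta 1 1 \<tau> z \<noteq> 0" "mumford_theta 0 0 \<tau> z \<noteq> 0"
    show "ch_plus (Lambda_K m m2) \<tau> z - ch_plus (Lambda_K m 0) \<tau> z =
            \<i> * qpow \<tau> (- (real m / 16)) * (1 / (dedekind_eta (\<tau> / 2) * dedekind_eta (2 * \<tau>))) *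
            (mumford_theta 0 0 \<tau> z / mumford_theta 1 1 \<tau> z) *
            (\<Sum>k<m2 div 2. (-1) ^ k *
               qpow \<tau> (- (1 / real m) * (real k + 1 / 2)\<^sup>2 + 1 / 2 * (real k + 1 / 2)) *
               theta_diff (real k + 1 / 2) (real m / 2) (2 * \<tau>) (2 * z))"
      by (subst N3_character_diff[OF assms(4,1,2) _ assms(3) nz n])
         (simp_all only: exp_neg_pi_i_nat_half, simp_all add: half sum_distrib_left sum_negf mult_ac)
  next
    assume "even m2"
    hence n: "(real m2 + 1) / 2 = 1 / 2 + real (m2 div 2)" by (auto elim!: evenE)
    assume nz: "mumford_theta 1 1 \<tau> z \<noteq> 0" "mumford_theta 0 1 \<tau> z \<noteq> 0"
    show "ch_minus (Lambda_K m m2) \<tau> z - ch_minus (Lambda_K m 0) \<tau> z =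
            - qpow \<tau> (- (real m / 16)) * (dedekind_eta (\<tau> / 2) / dedekind_eta \<tau> ^ 3) *
            (mumford_theta 0 1 \<tau> z / mumford_theta 1 1 \<tau> z) *
            (\<Sum>k<m2 div 2.
               qpow \<tau> (- (1 / real m) * (real k + 1 / 2)\<^sup>2 + 1 / 2 * (real k + 1 / 2)) *
               theta_diff (real k + 1 / 2) (real m / 2) (2 * \<tau>) (2 * z))"
      by (subst N3_supercharacter_diff[OF assms(5,1,2) _ assms(3) nz n])
         (simp_all add: half)
  next
    assume "odd m2"
    hence n: "(real m2 + 1) / 2 = 0 + real (Suc ((m2 - 1) div 2))"
      by (auto elim!: oddE)
    assume nz: "mumford_theta 1 1 \<tau> z \<noteq> 0" "mumford_theta 0 0 \<tau> z \<noteq> 0"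
    show "ch_plus (Lambda_K m m2) \<tau> z - ch_plus (Lambda_K m 1) \<tau> z =
            - qpow \<tau> (- (real m / 16)) * (1 / (dedekind_eta (\<tau> / 2) * dedekind_eta (2 * \<tau>))) *
            (mumford_theta 0 0 \<tau> z / mumford_theta 1 1 \<tau> z) *
            (\<Sum>k = 0..(m2 - 1) div 2. (-1) ^ k *
               qpow \<tau> (- ((real k)\<^sup>2 / real m) + real k / 2) *
               theta_diff (real k) (real m / 2) (2 * \<tau>) (2 * z))"
      unfolding up_to
      by (subst N3_character_diff[OF assms(4,1,2,1,3) nz n])
         (use Phi_one_eq_Phi_zero[OF m assms(3) nz(2), of "1 / 2"]
          in \<open>simp_all add: exp_neg_pi_i_nat[simplified] del: sum.lessThan_Suc\<close>)
  next
    assume "odd m2"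
    hence n: "(real m2 + 1) / 2 = 0 + real (Suc ((m2 - 1) div 2))"
      by (auto elim!: oddE)
    assume nz: "mumford_theta 1 1 \<tau> z \<noteq> 0" "mumford_theta 0 1 \<tau> z \<noteq> 0"
    show "ch_minus (Lambda_K m m2) \<tau> z - ch_minus (Lambda_K m 1) \<tau> z =
            - qpow \<tau> (- (real m / 16)) * (dedekind_eta (\<tau> / 2) / dedekind_eta \<tau> ^ 3) *
            (mumford_theta 0 1 \<tau> z / mumford_theta 1 1 \<tau> z) *
            (\<Sum>k = 0..(m2 - 1) div 2.
               qpow \<tau> (- ((real k)\<^sup>2 / real m) + real k / 2) *
               theta_diff (real k) (real m / 2) (2 * \<tau>) (2 * z))"
      unfolding up_to
      by (subst N3_supercharacter_diff[OF assms(5,1,2,1,3) nz n])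
         (use Phi_one_eq_Phi_zero[OF m assms(3) nz(2), of 0]
          in \<open>simp_all del: sum.lessThan_Suc\<close>)
  }
qed

end
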